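(* A finite directed graph $X$ is Eulerian if and only if it is cofibrant and obtained from a cycle by identifying nodes.
   Context: A directed graph $X$ consists of a set $X(0)$ of nodes, a set $X(1)$ of arcs, and two maps $s,t:X(1)\to X(0)$ (source and target); loops and parallel arcs are allowed. A morphism $f:X\to Y$ is a pair of maps $f(0):X(0)\to Y(0)$, $f(1):X(1)\to Y(1)$ commuting with $s$ and $t$. The category of directed graphs is denoted $Gph$; $\phi$ is its initial object (the empty graph) and $+$ denotes coproduct. For $n\ge 1$, $c_n$ is the directed cycle with $n$ nodes $x_0,\dots,x_{n-1}$ and $n$ arcs $a_i$ from $x_i$ to $x_{i+1}$ (indices mod $n$); the graph $c_0$ with one node and no arc is called the cycle of length $0$. An Eulerian cycle in a directed graph $X$ is a cycle, i.e. a morphism $f:c_n\to X$, such that $f(1)$ is a bijection. $X$ is Eulerian if it has an Eulerian cycle. "Obtained from a cycle by identifying nodes" means: isomorphic to the quotient of some $c_n$ by an equivalence relation on its set of nodes, with the set of arcs unchanged. Cofibrant: let $i_n:\phi\to c_n$ be the unique morphism and $j_n:c_n+c_n\to c_n$ the folding morphism (the identity on each summand). Let $Cof=\mathrm{cell}(\{i_n,j_n: n\ge 0\})$ be the class of retracts of transfinite compositions of pushouts of the morphisms $i_n,j_n$, $n\ge 0$ (these are the cofibrations of the closed model structure on $Gph$ whose weak equivalences are the morphisms inducing bijections on $\mathrm{Hom}(c_n,-)$ for all $n\ge 0$ and all of whose morphisms are fibrations). $X$ is cofibrant if $\phi\to X$ is in $Cof$.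
   Formalization: Added hypothesis: every node is an endpoint of an arc unless it is the only node (two nodes with no arc is Eulerian via c_0 but not a quotient of a cycle). Graphs, pushouts and colimits are taken with nodes and arcs in one arbitrary infinite set. *)

theory Defs
  imports
    "Graph_Theory.Digraph"
    "Graph_Theory.Digraph_Isomorphism"
    "HOL-Library.Infinite_Typeclass"
begin

section \<open>Directed graphs and their morphisms\<close>

text \<open>
  A directed graph is a \<^typ>\<open>('v, 'e) pre_digraph\<close> satisfying \<^const>\<open>wf_digraph\<close> (loops and
  parallel arcs are allowed).  A morphism is a pair of total functions that matters only through
  its restriction to the nodes and arcs of its domain, so that morphisms with domain \<open>X\<close> are
  compared by \<open>mor_eq X\<close> and never by \<open>=\<close>.
\<close>

type_synonym ('v, 'e, 'w, 'd) gph_mor = "('v \<Rightarrow> 'w) \<times> ('e \<Rightarrow> 'd)"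

definition gph_hom ::
  "('v, 'e) pre_digraph \<Rightarrow> ('w, 'd) pre_digraph \<Rightarrow> ('v, 'e, 'w, 'd) gph_mor set" where
  "gph_hom X Y = {f. wf_digraph X \<and> wf_digraph Y \<and>
     (\<forall>v\<in>verts X. fst f v \<in> verts Y) \<and>
     (\<forall>a\<in>arcs X. snd f a \<in> arcs Y \<and>
        tail Y (snd f a) = fst f (tail X a) \<and> head Y (snd f a) = fst f (head X a))}"

definition mor_eq ::
  "('v, 'e) pre_digraph \<Rightarrow> ('v, 'e, 'w, 'd) gph_mor \<Rightarrow> ('v, 'e, 'w, 'd) gph_mor \<Rightarrow> bool" where
  "mor_eq X f g \<longleftrightarrow> (\<forall>v\<in>verts X. fst f v = fst g v) \<and> (\<forall>a\<in>arcs X. snd f a = snd g a)"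

definition mor_comp ::
  "('w, 'd, 'x, 'c) gph_mor \<Rightarrow> ('v, 'e, 'w, 'd) gph_mor \<Rightarrow> ('v, 'e, 'x, 'c) gph_mor"
  (infixl "\<odot>" 70) where
  "g \<odot> f = (fst g \<circ> fst f, snd g \<circ> snd f)"

definition mor_id :: "('v, 'e, 'v, 'e) gph_mor" where
  "mor_id = (id, id)"

definition empty_gph :: "('v, 'e) pre_digraph" where
  "empty_gph = \<lparr>verts = {}, arcs = {}, tail = (\<lambda>_. undefined), head = (\<lambda>_. undefined)\<rparr>"

text \<open>The unique morphism out of the empty graph (its values are irrelevant).\<close>

definition initial_mor :: "('v, 'e, 'w, 'd) gph_mor" where
  "initial_mor = ((\<lambda>_. undefined), (\<lambda>_. undefined))"

definition gph_sum ::
  "('v, 'e) pre_digraph \<Rightarrow> ('w, 'd) pre_digraph \<Rightarrow> ('v + 'w, 'e + 'd) pre_digraph" where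
  "gph_sum X Y = \<lparr>verts = verts X <+> verts Y, arcs = arcs X <+> arcs Y,
     tail = map_sum (tail X) (tail Y), head = map_sum (head X) (head Y)\<rparr>"

definition fold_mor :: "('v + 'v, 'e + 'e, 'v, 'e) gph_mor" where
  "fold_mor = (case_sum id id, case_sum id id)"


section \<open>Cycles\<close>

text \<open>For \<open>n \<ge> 1\<close> the node set is \<open>{..<n}\<close>; for \<open>n = 0\<close> it is \<open>{0}\<close> and there is no arc.\<close>

definition cyc :: "nat \<Rightarrow> (nat, nat) pre_digraph" where
  "cyc n = \<lparr>verts = {..<max 1 n}, arcs = {..<n}, tail = (\<lambda>i. i), head = (\<lambda>i. Suc i mod n)\<rparr>"

definition eulerian :: "('v, 'e) pre_digraph \<Rightarrow> bool" where
  "eulerian X \<longleftrightarrow> (\<exists>n. \<exists>f\<in>gph_hom (cyc n) X. bij_betw (snd f) (arcs (cyc n)) (arcs X))"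

definition node_quotient :: "('v, 'e) pre_digraph \<Rightarrow> ('v \<times> 'v) set \<Rightarrow> ('v set, 'e) pre_digraph" where
  "node_quotient X R = \<lparr>verts = verts X // R, arcs = arcs X,
     tail = (\<lambda>a. R `` {tail X a}), head = (\<lambda>a. R `` {head X a})\<rparr>"

definition cycle_with_nodes_identified :: "('v, 'e) pre_digraph \<Rightarrow> bool" where
  "cycle_with_nodes_identified X \<longleftrightarrow>
     (\<exists>n R. equiv (verts (cyc n)) R \<and> digraph_iso (node_quotient (cyc n) R) X)"

text \<open>
  The definition of \<open>eulerian\<close> puts no condition on nodes, so an Eulerian graph may have
  isolated nodes off its Eulerian cycle, whereas a quotient of a cycle has an isolated node
  only if it is the one-node graph without arcs.  The two lemmas below show that such nodes must be
  excluded in order to compare the two notions, and that excluding them is no restriction on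
  quotients of cycles.
\<close>

definition no_extra_isolated_node :: "('v, 'e) pre_digraph \<Rightarrow> bool" where
  "no_extra_isolated_node X \<longleftrightarrow>
     (\<forall>v\<in>verts X. (\<exists>a\<in>arcs X. tail X a = v \<or> head X a = v) \<or> verts X = {v})"

lemma no_extra_isolated_node_if_cycle_with_nodes_identified:
  assumes "cycle_with_nodes_identified X"
  shows "no_extra_isolated_node X"
proof -
  from assms obtain n R f where
    iso: "pre_digraph.digraph_isomorphism (node_quotient (cyc n) R) f"
    and X: "X = app_iso f (node_quotient (cyc n) R)"
    unfolding cycle_with_nodes_identified_def digraph_iso_def by blast
  show ?thesis unfolding no_extra_isolated_node_def
  proof
    fix v assume "v \<in> verts X"
    then obtain x where x: "x < max 1 n" and v: "v = iso_verts f (R `` {x})"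
      unfolding X by (auto simp: app_iso_def node_quotient_def cyc_def quotient_def)
    show "(\<exists>a\<in>arcs X. tail X a = v \<or> head X a = v) \<or> verts X = {v}"
    proof (cases "n = 0")
      case True
      then show ?thesis
        using x v unfolding X by (auto simp: app_iso_def node_quotient_def cyc_def quotient_def)
    next
      case False
      then have "x < n" using x by (simp add: max_def split: if_splits)
      moreover from this have "tail X (iso_arcs f x) = v"
        using iso v unfolding X pre_digraph.digraph_isomorphism_def
        by (auto simp: app_iso_def node_quotient_def cyc_def)
      ultimately show ?thesis
        unfolding X by (auto simp: app_iso_def node_quotient_def cyc_def)
    qed
  qed
qed

lemma eulerian_not_cycle_with_nodes_identified:
  "\<exists>X :: (nat, nat) pre_digraph.
     fin_digraph X \<and> eulerian X \<and> \<not> cycle_with_nodes_identified X"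
proof -
  define X :: "(nat, nat) pre_digraph" where
    "X = \<lparr>verts = {0, 1}, arcs = {}, tail = id, head = id\<rparr>"
  have fin: "fin_digraph X" by unfold_locales (auto simp: X_def)
  have "(id, id) \<in> gph_hom (cyc 0) X"
    by (auto simp: gph_hom_def cyc_def X_def wf_digraph_def)
  then have "eulerian X"
    unfolding eulerian_def
    by (intro exI[of _ 0] bexI[of _ "(id, id)"]) (auto simp: cyc_def X_def)
  moreover have "\<not> no_extra_isolated_node X"
    by (auto simp: no_extra_isolated_node_def X_def)
  ultimately show ?thesis
    using fin no_extra_isolated_node_if_cycle_with_nodes_identified by blast
qed


section \<open>Cofibrations\<close>

text \<open>
  The category of graphs is taken relative to a universe of elements: its objects are the graphs
  whose nodes and arcs belong to an infinite type \<open>'u\<close>, that is, up to isomorphism, all graphs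
  with at most \<open>|'u|\<close> nodes and arcs.  This category is closed under the pushouts and the
  colimits of \<open>'u\<close>-indexed chains used below, so testing their universal properties against
  its objects determines the usual pushouts and colimits.
\<close>

type_synonym 'u gph = "('u, 'u) pre_digraph"
type_synonym 'u mor = "('u, 'u, 'u, 'u) gph_mor"

text \<open>
  \<open>is_pushout A B C D k f g w\<close>: in the square with \<open>k : A \<rightarrow> B\<close>, \<open>f : A \<rightarrow> C\<close>, \<open>g : B \<rightarrow> D\<close>,
  \<open>w : C \<rightarrow> D\<close>, the morphism \<open>w\<close> is the pushout of \<open>k\<close> along \<open>f\<close>.
\<close>

definition is_pushout ::
  "('a, 'b) pre_digraph \<Rightarrow> ('c, 'd) pre_digraph \<Rightarrow> 'u gph \<Rightarrow> 'u gph \<Rightarrow>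
   ('a, 'b, 'c, 'd) gph_mor \<Rightarrow> ('a, 'b, 'u, 'u) gph_mor \<Rightarrow>
   ('c, 'd, 'u, 'u) gph_mor \<Rightarrow> 'u mor \<Rightarrow> bool" where
  "is_pushout A B C D k f g w \<longleftrightarrow>
     k \<in> gph_hom A B \<and> f \<in> gph_hom A C \<and> g \<in> gph_hom B D \<and> w \<in> gph_hom C D \<and>
     mor_eq A (g \<odot> k) (w \<odot> f) \<and>
     (\<forall>(E::'u gph) p q.
        p \<in> gph_hom B E \<longrightarrow> q \<in> gph_hom C E \<longrightarrow> mor_eq A (p \<odot> k) (q \<odot> f) \<longrightarrow>
        (\<exists>h\<in>gph_hom D E. mor_eq B (h \<odot> g) p \<and> mor_eq C (h \<odot> w) q \<and>
           (\<forall>h'\<in>gph_hom D E. mor_eq B (h' \<odot> g) p \<longrightarrow> mor_eq C (h' \<odot> w) q \<longrightarrow> mor_eq D h' h)))"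

definition pushout_of_generator :: "'u gph \<Rightarrow> 'u gph \<Rightarrow> 'u mor \<Rightarrow> bool" where
  "pushout_of_generator C D w \<longleftrightarrow>
     (\<exists>n f g. is_pushout (empty_gph :: (nat, nat) pre_digraph) (cyc n) C D initial_mor f g w) \<or>
     (\<exists>n f g. is_pushout (gph_sum (cyc n) (cyc n)) (cyc n) C D fold_mor f g w)"

text \<open>
  Diagrams indexed by a subset \<open>J\<close> of the field of a well-order \<open>r\<close>: \<open>F i j : X i \<rightarrow> X j\<close> is the
  transition morphism for \<open>(i, j) \<in> r\<close>.
\<close>

definition is_diagram :: "'u rel \<Rightarrow> 'u set \<Rightarrow> ('u \<Rightarrow> 'u gph) \<Rightarrow> ('u \<Rightarrow> 'u \<Rightarrow> 'u mor) \<Rightarrow> bool" where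
  "is_diagram r J X F \<longleftrightarrow>
     (\<forall>i\<in>J. \<forall>j\<in>J. (i, j) \<in> r \<longrightarrow> F i j \<in> gph_hom (X i) (X j)) \<and>
     (\<forall>i\<in>J. mor_eq (X i) (F i i) mor_id) \<and>
     (\<forall>i\<in>J. \<forall>j\<in>J. \<forall>k\<in>J. (i, j) \<in> r \<longrightarrow> (j, k) \<in> r \<longrightarrow> mor_eq (X i) (F j k \<odot> F i j) (F i k))"

definition is_cocone ::
  "'u rel \<Rightarrow> 'u set \<Rightarrow> ('u \<Rightarrow> 'u gph) \<Rightarrow> ('u \<Rightarrow> 'u \<Rightarrow> 'u mor) \<Rightarrow>
   'u gph \<Rightarrow> ('u \<Rightarrow> 'u mor) \<Rightarrow> bool" where
  "is_cocone r J X F L c \<longleftrightarrow>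
     (\<forall>i\<in>J. c i \<in> gph_hom (X i) L) \<and>
     (\<forall>i\<in>J. \<forall>j\<in>J. (i, j) \<in> r \<longrightarrow> mor_eq (X i) (c j \<odot> F i j) (c i))"

definition is_colimit ::
  "'u rel \<Rightarrow> 'u set \<Rightarrow> ('u \<Rightarrow> 'u gph) \<Rightarrow> ('u \<Rightarrow> 'u \<Rightarrow> 'u mor) \<Rightarrow>
   'u gph \<Rightarrow> ('u \<Rightarrow> 'u mor) \<Rightarrow> bool" where
  "is_colimit r J X F L c \<longleftrightarrow>
     is_cocone r J X F L c \<and>
     (\<forall>E d. is_cocone r J X F E d \<longrightarrow>
        (\<exists>h\<in>gph_hom L E. (\<forall>i\<in>J. mor_eq (X i) (h \<odot> c i) (d i)) \<and>
           (\<forall>h'\<in>gph_hom L E. (\<forall>i\<in>J. mor_eq (X i) (h' \<odot> c i) (d i)) \<longrightarrow> mor_eq L h' h)))"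

definition is_least :: "'u rel \<Rightarrow> 'u \<Rightarrow> bool" where
  "is_least r i \<longleftrightarrow> i \<in> Field r \<and> (\<forall>j\<in>Field r. (i, j) \<in> r)"

definition is_pred :: "'u rel \<Rightarrow> 'u \<Rightarrow> 'u \<Rightarrow> bool" where
  "is_pred r i j \<longleftrightarrow> i \<in> underS r j \<and> (\<forall>k\<in>underS r j. (k, i) \<in> r)"

text \<open>
  \<open>w : A \<rightarrow> L\<close> is a transfinite composition of pushouts of generators: there is a chain indexed
  by a nonempty well-order, starting at \<open>A\<close>, whose successor steps are pushouts of generators,
  which is continuous at limit indices, and \<open>w\<close> is the coprojection of \<open>A\<close> into its colimit \<open>L\<close>.
\<close>

definition transfinite_comp :: "'u gph \<Rightarrow> 'u gph \<Rightarrow> 'u mor \<Rightarrow> bool" where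
  "transfinite_comp A L w \<longleftrightarrow>
     (\<exists>r X F c z. Well_order r \<and> is_diagram r (Field r) X F \<and>
        is_least r z \<and> X z = A \<and>
        (\<forall>i j. is_pred r i j \<longrightarrow> pushout_of_generator (X i) (X j) (F i j)) \<and>
        (\<forall>j\<in>Field r. \<not> is_least r j \<longrightarrow> (\<nexists>i. is_pred r i j) \<longrightarrow>
           is_colimit r (underS r j) X F (X j) (\<lambda>i. F i j)) \<and>
        is_colimit r (Field r) X F L c \<and> mor_eq A w (c z))"

text \<open>\<open>f : A \<rightarrow> B\<close> is a retract of \<open>g : C \<rightarrow> D\<close> in the category of arrows.\<close>

definition is_retract ::
  "'u gph \<Rightarrow> 'u gph \<Rightarrow> 'u mor \<Rightarrow> 'u gph \<Rightarrow> 'u gph \<Rightarrow> 'u mor \<Rightarrow> bool" where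
  "is_retract A B f C D g \<longleftrightarrow>
     f \<in> gph_hom A B \<and> g \<in> gph_hom C D \<and>
     (\<exists>s\<in>gph_hom A C. \<exists>p\<in>gph_hom C A. \<exists>t\<in>gph_hom B D. \<exists>q\<in>gph_hom D B.
        mor_eq A (p \<odot> s) mor_id \<and> mor_eq B (q \<odot> t) mor_id \<and>
        mor_eq A (g \<odot> s) (t \<odot> f) \<and> mor_eq C (f \<odot> p) (q \<odot> g))"

definition cofibration :: "('u::infinite) gph \<Rightarrow> 'u gph \<Rightarrow> 'u mor \<Rightarrow> bool" where
  "cofibration A B f \<longleftrightarrow> (\<exists>C D g. transfinite_comp C D g \<and> is_retract A B f C D g)"

definition cofibrant :: "('u::infinite) gph \<Rightarrow> bool" where
  "cofibrant X \<longleftrightarrow> cofibration empty_gph X initial_mor"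

end

theory Submission
  imports Defs
begin

text \<open>
  The folding morphism \<open>j\<^sub>0 : c\<^sub>0 + c\<^sub>0 \<rightarrow> c\<^sub>0\<close> has nodes without arcs at both ends, so a pushout of it
  glues two nodes together.  Hence a quotient of \<open>c\<^sub>n\<close> on its nodes is a finite composition of one
  pushout of \<open>i\<^sub>n\<close> and some pushouts of \<open>j\<^sub>0\<close>, and is cofibrant.  On the other hand an Eulerian
  cycle exhibits \<open>X\<close> as the quotient of \<open>c\<^sub>n\<close> by the kernel of its node map, which is onto since
  every node lies on an arc.
\<close>

section \<open>Eulerian graphs as quotients of cycles\<close>

lemma wf_cyc: "wf_digraph (cyc n)"
  by unfold_locales (auto simp: cyc_def)

lemmas cyc_ends = wf_digraph.tail_in_verts[OF wf_cyc] wf_digraph.head_in_verts[OF wf_cyc]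

lemma verts_empty_gph [simp]: "verts empty_gph = {}"
  by (simp add: empty_gph_def)

lemma arcs_empty_gph [simp]: "arcs empty_gph = {}"
  by (simp add: empty_gph_def)

lemma wf_empty_gph [simp]: "wf_digraph empty_gph"
  by unfold_locales auto

text \<open>A node quotient leaves the arcs alone, so the projection from \<open>cyc n\<close>
  followed by the isomorphism onto \<open>X\<close> is an Eulerian cycle.\<close>

lemma eulerian_if_cycle_with_nodes_identified:
  assumes "wf_digraph X" and "cycle_with_nodes_identified X"
  shows "eulerian X"
proof -
  from assms(2) obtain n R f where R: "equiv (verts (cyc n)) R"
    and iso: "pre_digraph.digraph_isomorphism (node_quotient (cyc n) R) f"
    and X: "X = app_iso f (node_quotient (cyc n) R)"
    unfolding cycle_with_nodes_identified_def digraph_iso_def by blast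
  let ?h = "(\<lambda>x. iso_verts f (R `` {x}), iso_arcs f)"
  have "?h \<in> gph_hom (cyc n) X"
    using iso assms(1) wf_cyc[of n] unfolding gph_hom_def
    by (auto simp: X pre_digraph.digraph_isomorphism_def node_quotient_def app_iso_def quotient_def)
  moreover have "bij_betw (snd ?h) (arcs (cyc n)) (arcs X)"
    using iso
    by (auto simp: X pre_digraph.digraph_isomorphism_def node_quotient_def app_iso_def bij_betw_def)
  ultimately show ?thesis
    unfolding eulerian_def by blast
qed

lemma eulerian_cycle_onto_verts:
  assumes "no_extra_isolated_node X" and f: "f \<in> gph_hom (cyc n) X"
    and bij: "bij_betw (snd f) (arcs (cyc n)) (arcs X)"
  shows "fst f ` verts (cyc n) = verts X"
proof (intro equalityI subsetI)
  fix v assume v: "v \<in> verts X"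
  with assms(1) consider a where "a \<in> arcs X" "tail X a = v \<or> head X a = v" | "verts X = {v}"
    unfolding no_extra_isolated_node_def by blast
  then show "v \<in> fst f ` verts (cyc n)"
  proof cases
    case 1
    then obtain i where "i \<in> arcs (cyc n)" "a = snd f i"
      using bij by (auto simp: bij_betw_def)
    with 1 f show ?thesis
      by (auto simp: gph_hom_def wf_digraph_def)
  next
    case 2
    \<comment> \<open>The node \<open>0\<close> is present even for \<open>n = 0\<close>, so a
      single node without arcs is reached too.\<close>
    have "0 \<in> verts (cyc n)" by (simp add: cyc_def)
    with 2 f have "fst f 0 = v" unfolding gph_hom_def by blast
    with \<open>0 \<in> verts (cyc n)\<close> show ?thesis by blast
  qed
qed (use f in \<open>auto simp: gph_hom_def\<close>)

text \<open>First isomorphism theorem for nodes: the kernel \<open>R\<close> of the node map makes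
  the induced map injective on classes, and \<open>onto\<close> makes it surjective.\<close>

lemma cycle_with_nodes_identified_if_onto:
  assumes f: "f \<in> gph_hom (cyc n) X"
    and bij: "bij_betw (snd f) (arcs (cyc n)) (arcs X)"
    and onto: "fst f ` verts (cyc n) = verts X"
  shows "cycle_with_nodes_identified X"
proof -
  define R where "R = {(x, y) \<in> verts (cyc n) \<times> verts (cyc n). fst f x = fst f y}"
  have R: "equiv (verts (cyc n)) R"
    by (rule equivI) (auto simp: R_def refl_on_def sym_def trans_def)
  \<comment> \<open>The choice of representative is harmless because \<open>fst f\<close> is
    constant on each class of \<open>R\<close>.\<close>
  define h where "h = \<lparr>iso_verts = (\<lambda>A. fst f (SOME x. x \<in> A)), iso_arcs = snd f,
    iso_head = head X, iso_tail = tail X\<rparr>"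
  have h: "iso_verts h (R `` {x}) = fst f x" if "x \<in> verts (cyc n)" for x
  proof -
    have "x \<in> R `` {x}" using that by (auto simp: R_def)
    then have "(SOME x'. x' \<in> R `` {x}) \<in> R `` {x}" by (rule someI)
    then show ?thesis by (auto simp: h_def R_def)
  qed
  have wf: "wf_digraph (node_quotient (cyc n) R)"
    using wf_cyc[of n] by (auto simp: node_quotient_def wf_digraph_def quotient_def)
  have inj: "inj_on (iso_verts h) (verts (cyc n) // R)"
  proof (rule inj_onI)
    fix A B assume "A \<in> verts (cyc n) // R" "B \<in> verts (cyc n) // R"
      and eq: "iso_verts h A = iso_verts h B"
    then obtain x y where "x \<in> verts (cyc n)" "A = R `` {x}" "y \<in> verts (cyc n)" "B = R `` {y}"
      by (auto simp: quotient_def)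
    with eq h show "A = B" by (auto simp: R_def)
  qed
  have "pre_digraph.digraph_isomorphism (node_quotient (cyc n) R) h"
    using wf inj bij f unfolding pre_digraph.digraph_isomorphism_def
    by (auto simp: node_quotient_def h cyc_ends bij_betw_def gph_hom_def) (auto simp: h_def)
  moreover have "X = app_iso h (node_quotient (cyc n) R)"
  proof -
    have "iso_verts h ` (verts (cyc n) // R) = verts X"
      by (simp add: quotient_def UNION_singleton_eq_range image_image h onto[symmetric])
    then show ?thesis
      using bij
      by (intro pre_digraph.equality) (simp_all add: app_iso_def node_quotient_def h_def bij_betw_def)
  qed
  ultimately show ?thesis
    using R unfolding cycle_with_nodes_identified_def digraph_iso_def by blast
qed

section \<open>Pushouts of the generators\<close>

text \<open>Pushing out along a map of empty graphs only copies \<open>cyc n\<close>, so any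
  isomorphic copy \<open>D\<close> will do: the mediating morphism is \<open>p\<close> after the
  inverse of \<open>g\<close>. Morphisms out of the empty graph carry no data, whence the free
  \<open>f\<close> and \<open>w\<close>.\<close>

lemma is_pushout_initial_cyc:
  assumes wf: "wf_digraph D" and g: "g \<in> gph_hom (cyc n) D"
    and v: "bij_betw (fst g) (verts (cyc n)) (verts D)"
    and a: "bij_betw (snd g) (arcs (cyc n)) (arcs D)"
  shows "is_pushout (empty_gph :: ('a, 'b) pre_digraph) (cyc n) empty_gph D initial_mor f g w"
  unfolding is_pushout_def
proof (intro conjI allI impI)
  fix E :: "'c gph" and p q
  assume p: "p \<in> gph_hom (cyc n) E"
  define h where "h = (fst p \<circ> inv_into (verts (cyc n)) (fst g), snd p \<circ> inv_into (arcs (cyc n)) (snd g))"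
  have hv: "fst h (fst g x) = fst p x" if "x \<in> verts (cyc n)" for x
    using that v by (simp add: h_def bij_betw_def)
  have ha: "snd h (snd g x) = snd p x" if "x \<in> arcs (cyc n)" for x
    using that a by (simp add: h_def bij_betw_def)
  have V: "verts D = fst g ` verts (cyc n)" and A: "arcs D = snd g ` arcs (cyc n)"
    using v a by (auto simp: bij_betw_def)
  have "h \<in> gph_hom D E"
    using p g wf by (auto simp: gph_hom_def V A hv ha cyc_ends)
  then show "\<exists>h\<in>gph_hom D E. mor_eq (cyc n) (h \<odot> g) p \<and> mor_eq empty_gph (h \<odot> w) q \<and>
      (\<forall>h'\<in>gph_hom D E. mor_eq (cyc n) (h' \<odot> g) p \<longrightarrow> mor_eq empty_gph (h' \<odot> w) q \<longrightarrow> mor_eq D h' h)"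
    by (intro bexI[of _ h]) (auto simp: mor_eq_def mor_comp_def hv ha V A)
qed (use g wf in \<open>auto simp: gph_hom_def mor_eq_def wf_cyc\<close>)

text \<open>A pushout of the folding of two single nodes merges \<open>a\<close> into
  \<open>b\<close>. Keeping \<open>b\<close> as the name of the merged node makes the nodes of
  \<open>D\<close> nodes of \<open>C\<close>.\<close>

lemma is_pushout_glue:
  assumes wf: "wf_digraph C"
    and ab: "a \<in> verts C" "b \<in> verts C" "a = b \<or> a \<notin> verts D"
    and V: "verts D = fst w ` verts C" and A: "arcs D = arcs C"
    and wv: "\<And>v. v \<in> verts C \<Longrightarrow> fst w v = (if v = a then b else v)"
    and wa: "\<And>e. e \<in> arcs C \<Longrightarrow> snd w e = e \<and>
      tail D e = fst w (tail C e) \<and> head D e = fst w (head C e)"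
  shows "is_pushout (gph_sum (cyc 0) (cyc 0)) (cyc 0) C D fold_mor
    (case_sum (\<lambda>_. a) (\<lambda>_. b), f) ((\<lambda>_. b), g) w"
proof -
  have wfD: "wf_digraph D"
    using wf by (auto simp: wf_digraph_def V A wa)
  have wfS: "wf_digraph (gph_sum (cyc 0) (cyc 0))"
    by (auto simp: wf_digraph_def gph_sum_def cyc_def)
  have b: "b \<in> verts D" unfolding V using wv ab by force
  have w: "w \<in> gph_hom C D"
    using wf wfD by (auto simp: gph_hom_def V A wa)
  show ?thesis
    unfolding is_pushout_def
  proof (intro conjI allI impI)
    fix E :: "'a gph" and p q
    assume p: "p \<in> gph_hom (cyc 0) E" and q: "q \<in> gph_hom C E"
      and eq: "mor_eq (gph_sum (cyc 0) (cyc 0)) (p \<odot> fold_mor)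
         (q \<odot> (case_sum (\<lambda>_. a) (\<lambda>_. b), f))"
    have qa: "fst q a = fst p 0" and qb: "fst q b = fst p 0"
      using eq by (auto simp: mor_eq_def mor_comp_def fold_mor_def gph_sum_def cyc_def Plus_def
          lessThan_Suc)
    have qw: "fst q (fst w v) = fst q v" if "v \<in> verts C" for v
      using that by (simp add: wv qa qb)
    \<comment> \<open>The mediating morphism is \<open>q\<close> itself: it agrees at
      \<open>a\<close> and \<open>b\<close>, so \<open>w\<close> does not change its values.\<close>
    have "q \<in> gph_hom D E"
      using q wfD by (auto simp: gph_hom_def V A wa qw wf_digraph.tail_in_verts[OF wf]
          wf_digraph.head_in_verts[OF wf])
    then show "\<exists>h\<in>gph_hom D E. mor_eq (cyc 0) (h \<odot> ((\<lambda>_. b), g)) p \<and> mor_eq C (h \<odot> w) q \<and>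
      (\<forall>h'\<in>gph_hom D E. mor_eq (cyc 0) (h' \<odot> ((\<lambda>_. b), g)) p \<longrightarrow> mor_eq C (h' \<odot> w) q \<longrightarrow> mor_eq D h' h)"
      by (intro bexI[of _ q]) (auto simp: mor_eq_def mor_comp_def qw qb wa V A cyc_def)
  qed (use wf wfD wfS w ab b wv wf_cyc[of 0] in
      \<open>auto simp: gph_hom_def mor_eq_def mor_comp_def fold_mor_def gph_sum_def cyc_def\<close>)
qed

section \<open>Finite compositions as transfinite ones\<close>

text \<open>A finite chain has no limit indices, and its colimit is its last graph. Since the index
  order must live on \<open>'u\<close>, the numbers up to \<open>m\<close> are embedded there by an
  injection \<open>g\<close>.\<close>

lemma transfinite_comp_finite:
  fixes Y :: "nat \<Rightarrow> ('u::infinite) gph"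
  assumes hom: "\<And>i j. i \<le> j \<Longrightarrow> j \<le> m \<Longrightarrow> F i j \<in> gph_hom (Y i) (Y j)"
    and ident: "\<And>i. i \<le> m \<Longrightarrow> mor_eq (Y i) (F i i) mor_id"
    and comp: "\<And>i j k. i \<le> j \<Longrightarrow> j \<le> k \<Longrightarrow> k \<le> m \<Longrightarrow> mor_eq (Y i) (F j k \<odot> F i j) (F i k)"
    and push: "\<And>i. i < m \<Longrightarrow> pushout_of_generator (Y i) (Y (Suc i)) (F i (Suc i))"
  shows "transfinite_comp (Y 0) (Y m) (F 0 m)"
proof -
  obtain g :: "nat \<Rightarrow> 'u" where g: "inj g"
    using infinite_UNIV infinite_countable_subset by blast
  define n where "n = inv g"
  have n [simp]: "n (g i) = i" for i using g by (simp add: n_def)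
  have gg [simp]: "g i = g j \<longleftrightarrow> i = j" for i j using g by (simp add: inj_eq)
  define r where "r = {(g i, g j) | i j. i \<le> j \<and> j \<le> m}"
  have r [simp]: "(g i, g j) \<in> r \<longleftrightarrow> i \<le> j \<and> j \<le> m" for i j by (auto simp: r_def)
  have Fr: "Field r = g ` {..m}"
    by (auto simp: Field_def r_def)
  have "Linear_order r"
    unfolding linear_order_on_def partial_order_on_def preorder_on_def refl_on_def
      total_on_def Fr antisym_def trans_def
    by (auto simp: r_def)
  moreover have "wf (r - Id)"
    by (rule wf_subset[OF wf_inv_image[OF wf_less_than, of n]]) (auto simp: r_def)
  ultimately have wo: "Well_order r"
    unfolding well_order_on_def by blast
  have least: "is_least r (g i) \<longleftrightarrow> i = 0" if "i \<le> m" for i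
    using that by (auto simp: is_least_def Fr)
  have predE: "\<exists>k. i = g k \<and> j = g (Suc k) \<and> k < m" if ij: "is_pred r i j" for i j
  proof -
    from ij obtain k l where kl: "i = g k" "j = g l" "k \<noteq> l" "k \<le> l" "l \<le> m"
      by (auto simp: is_pred_def underS_def r_def)
    \<comment> \<open>The index just below \<open>l\<close> lies below the predecessor, which forces
      \<open>k = l - 1\<close>.\<close>
    have "g (l - 1) \<in> underS r j" using kl by (auto simp: underS_def)
    then have "l - 1 \<le> k" using ij kl by (auto simp: is_pred_def)
    with kl show ?thesis by (intro exI[of _ k]) auto
  qed
  have predI: "is_pred r (g k) (g (Suc k))" if "k < m" for k
    using that by (auto simp: is_pred_def underS_def r_def)
  let ?X = "\<lambda>i. Y (n i)" and ?F = "\<lambda>i j. F (n i) (n j)" and ?c = "\<lambda>i. F (n i) m"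
  have "is_diagram r (Field r) ?X ?F"
    using hom ident comp by (auto simp: is_diagram_def Fr)
  moreover have "is_least r (g 0)" by (simp add: least)
  moreover have "\<forall>i j. is_pred r i j \<longrightarrow> pushout_of_generator (?X i) (?X j) (?F i j)"
    using predE push by fastforce
  \<comment> \<open>This makes the continuity condition at limit indices vacuous.\<close>
  moreover have "\<exists>i. is_pred r i j" if j: "j \<in> Field r" "\<not> is_least r j" for j
  proof -
    from j(1) obtain l where l: "j = g l" "l \<le> m" by (auto simp: Fr)
    with j(2) least obtain k where "l = Suc k" by (cases l) auto
    with l predI[of k] show ?thesis by (intro exI[of _ "g k"]) simp
  qed
  moreover have "is_colimit r (Field r) ?X ?F (Y m) ?c"
    unfolding is_colimit_def
  proof (intro conjI allI impI)
    show "is_cocone r (Field r) ?X ?F (Y m) ?c"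
      using hom comp by (auto simp: is_cocone_def Fr)
    fix E :: "'u gph" and d assume d: "is_cocone r (Field r) ?X ?F E d"
    \<comment> \<open>The component of the cocone at the last index is the mediating
      morphism.\<close>
    have "d (g m) \<in> gph_hom (Y m) E"
      using d by (auto simp: is_cocone_def Fr)
    moreover have "\<forall>i\<in>Field r. mor_eq (?X i) (d (g m) \<odot> ?c i) (d i)"
      using d by (auto simp: is_cocone_def Fr)
    moreover have "mor_eq (Y m) h' (d (g m))"
      if "\<forall>i\<in>Field r. mor_eq (?X i) (h' \<odot> ?c i) (d i)" for h'
    proof -
      have "mor_eq (Y m) (h' \<odot> F m m) (d (g m))"
        using that by (auto simp: Fr)
      with ident[of m] show ?thesis
        by (simp add: mor_eq_def mor_comp_def mor_id_def)
    qed
    ultimately show "\<exists>h\<in>gph_hom (Y m) E. (\<forall>i\<in>Field r. mor_eq (?X i) (h \<odot> ?c i) (d i)) \<and>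
        (\<forall>h'\<in>gph_hom (Y m) E. (\<forall>i\<in>Field r. mor_eq (?X i) (h' \<odot> ?c i) (d i)) \<longrightarrow> mor_eq (Y m) h' h)"
      by blast
  qed
  moreover have "?X (g 0) = Y 0" "mor_eq (Y 0) (F 0 m) (?c (g 0))"
    by (simp_all add: mor_eq_def)
  ultimately show ?thesis
    unfolding transfinite_comp_def using wo by blast
qed

section \<open>Gluing the nodes of a cycle one at a time\<close>

text \<open>
  \<open>glue_to e k\<close> moves each of the nodes \<open>0, \<dots>, k - 1\<close> of a cycle to the first node with the same
  image under \<open>e\<close>, so that passing from \<open>k\<close> to \<open>k + 1\<close> identifies at most one pair of nodes.
\<close>

definition glue_to :: "(nat \<Rightarrow> 'w) \<Rightarrow> nat \<Rightarrow> nat \<Rightarrow> nat" where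
  "glue_to e k x = (if x < k then (LEAST y. e y = e x) else x)"

lemma glue_to_0 [simp]: "glue_to e 0 x = x"
  by (simp add: glue_to_def)

lemma glue_to_le: "glue_to e k x \<le> x"
  by (auto simp: glue_to_def intro: Least_le)

lemma glue_to_same [simp]: "e (glue_to e k x) = e x"
  unfolding glue_to_def by (auto intro: LeastI)

text \<open>A node below \<open>k\<close> and its replacement are both below \<open>l\<close> and
  have the same value under \<open>e\<close>, hence the same least representative.\<close>

lemma glue_to_glue_to:
  assumes "k \<le> l"
  shows "glue_to e l (glue_to e k x) = glue_to e l x"
proof (cases "x < k")
  case True
  have "glue_to e k x < l" using glue_to_le[of e k x] True assms by linarith
  then show ?thesis
    using True assms glue_to_same[of e k x] unfolding glue_to_def by auto
qed (simp add: glue_to_def)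

text \<open>Among the nodes present at stage \<open>k\<close>, only \<open>k\<close> can still move;
  this is the shape that \<open>is_pushout_glue\<close> expects.\<close>

lemma glue_to_Suc:
  "glue_to e (Suc k) (glue_to e k x) =
    (if glue_to e k x = k then glue_to e (Suc k) k else glue_to e k x)"
proof (cases "x < k")
  case True
  then have "glue_to e k x < k" using glue_to_le[of e k x] by linarith
  moreover have "glue_to e k (glue_to e k x) = glue_to e k x" by (rule glue_to_glue_to) simp
  ultimately show ?thesis by (simp add: glue_to_def)
qed (auto simp: glue_to_def)

text \<open>Classes are represented by their least members, transported by \<open>g\<close>, so that
  every stage is a graph on \<open>'u\<close>. For injective \<open>g\<close>, stage
  \<open>0\<close> is a copy of \<open>cyc n\<close>.\<close>

definition glued_cyc :: "(nat \<Rightarrow> 'u) \<Rightarrow> nat \<Rightarrow> (nat \<Rightarrow> 'w) \<Rightarrow> nat \<Rightarrow> 'u gph" where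
  "glued_cyc g n e k = \<lparr>verts = (\<lambda>x. g (glue_to e k x)) ` verts (cyc n), arcs = g ` arcs (cyc n),
     tail = (\<lambda>a. g (glue_to e k (tail (cyc n) (inv g a)))),
     head = (\<lambda>a. g (glue_to e k (head (cyc n) (inv g a))))\<rparr>"

text \<open>Only the target stage \<open>k\<close> enters: by \<open>glue_to_glue_to\<close> the
  same formula serves every earlier source stage.\<close>

definition glued_mor :: "(nat \<Rightarrow> 'u) \<Rightarrow> (nat \<Rightarrow> 'w) \<Rightarrow> nat \<Rightarrow> 'u mor" where
  "glued_mor g e k = ((\<lambda>v. g (glue_to e k (inv g v))), id)"

lemma wf_glued_cyc:
  assumes "inj g"
  shows "wf_digraph (glued_cyc g n e k)"
  using assms wf_cyc[of n] by (auto simp: wf_digraph_def glued_cyc_def)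

lemma glued_mor_hom:
  assumes "inj g" "k \<le> l"
  shows "glued_mor g e l \<in> gph_hom (glued_cyc g n e k) (glued_cyc g n e l)"
  using assms wf_glued_cyc[OF assms(1)]
  by (auto simp: gph_hom_def glued_mor_def glued_cyc_def glue_to_glue_to)

text \<open>The step glues \<open>k\<close> to the first node with its value under \<open>e\<close>.
  If that is \<open>k\<close> itself, both copies of \<open>cyc 0\<close> hit one node and nothing
  changes.\<close>

lemma pushout_glued_mor:
  assumes g: "inj g" and k: "k \<in> verts (cyc n)"
  shows "pushout_of_generator (glued_cyc g n e k) (glued_cyc g n e (Suc k)) (glued_mor g e (Suc k))"
proof -
  let ?C = "glued_cyc g n e k" and ?D = "glued_cyc g n e (Suc k)" and ?w = "glued_mor g e (Suc k)"
  let ?j = "glue_to e (Suc k) k"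
  have j: "?j \<le> k" by (rule glue_to_le)
  have [simp]: "g x = g y \<longleftrightarrow> x = y" "inv g (g x) = x" for x y
    using g by (simp_all add: inj_eq)
  have kk: "glue_to e k k = k" by (simp add: glue_to_def)
  have jj: "glue_to e k ?j = ?j"
    using glue_to_same[of e "Suc k" k] by (simp add: glue_to_def)
  have jv: "?j \<in> verts (cyc n)" using j k by (auto simp: cyc_def)
  have V: "verts ?D = fst ?w ` verts ?C"
    by (simp add: glued_cyc_def glued_mor_def image_image glue_to_glue_to)
  have "is_pushout (gph_sum (cyc 0) (cyc 0)) (cyc 0) ?C ?D fold_mor
      (case_sum (\<lambda>_. g k) (\<lambda>_. g ?j), \<lambda>_. undefined) ((\<lambda>_. g ?j), \<lambda>_. undefined) ?w"
  proof (rule is_pushout_glue)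
    show "wf_digraph ?C" by (rule wf_glued_cyc[OF g])
    show "g k \<in> verts ?C" using k kk by (force simp: glued_cyc_def)
    show "g ?j \<in> verts ?C" using jv jj by (force simp: glued_cyc_def)
    show "g k = g ?j \<or> g k \<notin> verts ?D"
    proof (rule disjCI)
      assume "\<not> g k \<notin> verts ?D"
      then obtain x where "k = glue_to e (Suc k) x" by (auto simp: glued_cyc_def)
      \<comment> \<open>By idempotence of \<open>glue_to e (Suc k)\<close>, a node in its range is
        fixed by it.\<close>
      then show "g k = g ?j" by (metis glue_to_glue_to order_refl)
    qed
    show "fst ?w v = (if v = g k then g ?j else v)" if "v \<in> verts ?C" for v
      using that by (auto simp: glued_cyc_def glued_mor_def glue_to_Suc)
  qed (use V in \<open>auto simp: glued_cyc_def glued_mor_def glue_to_glue_to\<close>)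
  then show ?thesis
    unfolding pushout_of_generator_def by blast
qed

lemma pushout_cyc_glued_0:
  assumes g: "inj g"
  shows "pushout_of_generator empty_gph (glued_cyc g n e 0) w"
proof -
  have "is_pushout (empty_gph :: (nat, nat) pre_digraph) (cyc n) empty_gph (glued_cyc g n e 0)
      initial_mor f (g, g) w" for f
  proof (rule is_pushout_initial_cyc)
    show "wf_digraph (glued_cyc g n e 0)" by (rule wf_glued_cyc[OF g])
    then show "(g, g) \<in> gph_hom (cyc n) (glued_cyc g n e 0)"
      using g by (simp add: gph_hom_def wf_cyc) (auto simp: glued_cyc_def)
  qed (use g in \<open>auto simp: glued_cyc_def bij_betw_def inj_on_def\<close>)
  then show ?thesis
    unfolding pushout_of_generator_def by blast
qed

lemma transfinite_comp_glued_cyc: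
  fixes g :: "nat \<Rightarrow> 'u::infinite"
  assumes g: "inj g" and "k \<le> max 1 n"
  shows "transfinite_comp empty_gph (glued_cyc g n e k) (glued_mor g e k)"
proof -
  \<comment> \<open>Putting the empty graph in front shifts the stages by one, hence
    \<open>j - 1\<close> below. At \<open>j = 0\<close> the truncated value is harmless, as the
    source is empty.\<close>
  define Y where "Y = case_nat empty_gph (glued_cyc g n e)"
  have "transfinite_comp (Y 0) (Y (Suc k)) (glued_mor g e (Suc k - 1))"
  proof (rule transfinite_comp_finite[where F = "\<lambda>i j. glued_mor g e (j - 1)"])
    show "glued_mor g e (j - 1) \<in> gph_hom (Y i) (Y j)" if "i \<le> j" for i j
      using that glued_mor_hom[OF g] wf_glued_cyc[OF g]
      by (cases i; cases j) (auto simp: Y_def gph_hom_def)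
    show "mor_eq (Y i) (glued_mor g e (i - 1)) mor_id" for i
      using g by (cases i) (auto simp: Y_def mor_eq_def glued_mor_def mor_id_def
          glued_cyc_def glue_to_glue_to)
    show "mor_eq (Y i) (glued_mor g e (k - 1) \<odot> glued_mor g e (j - 1)) (glued_mor g e (k - 1))"
      if "i \<le> j" "j \<le> k" for i j k
      using g that by (cases i) (auto simp: Y_def mor_eq_def glued_mor_def mor_comp_def
          glue_to_glue_to)
    show "pushout_of_generator (Y i) (Y (Suc i)) (glued_mor g e (Suc i - 1))" if "i < Suc k" for i
    proof (cases i)
      case 0
      with pushout_cyc_glued_0[OF g] show ?thesis by (simp add: Y_def)
    next
      case (Suc l)
      with that assms(2) have "l \<in> verts (cyc n)" by (simp add: cyc_def)
      with Suc pushout_glued_mor[OF g] show ?thesis by (simp add: Y_def)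
    qed
  qed
  then show ?thesis by (simp add: Y_def)
qed

section \<open>Cofibrancy of quotients of cycles\<close>

text \<open>Gluing all nodes of the cycle along \<open>fst f\<close> yields a copy of
  \<open>X\<close> on other elements. Being a retract of it transfers cofibrancy to
  \<open>X\<close>, so only \<open>q\<close> after \<open>t\<close> has to be the identity.\<close>

lemma cofibrant_if_onto:
  fixes X :: "('u::infinite) gph"
  assumes f: "f \<in> gph_hom (cyc n) X"
    and bij: "bij_betw (snd f) (arcs (cyc n)) (arcs X)"
    and onto: "fst f ` verts (cyc n) = verts X"
  shows "cofibrant X"
proof -
  obtain g :: "nat \<Rightarrow> 'u" where g: "inj g"
    using infinite_UNIV infinite_countable_subset by blast
  \<comment> \<open>This is the number of nodes of \<open>cyc n\<close>, so at stage
    \<open>N\<close> every node has been replaced by its least representative.\<close>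
  define N where "N = max 1 n"
  let ?e = "fst f"
  let ?D = "glued_cyc g n ?e N"
  let ?l = "\<lambda>v. LEAST y. ?e y = v"
  define t where "t = (\<lambda>v. g (?l v), \<lambda>a. g (inv_into (arcs (cyc n)) (snd f) a))"
  define q where "q = (\<lambda>v. ?e (inv g v), \<lambda>a. snd f (inv g a))"
  have gl: "glue_to ?e N x = ?l (?e x)" if "x \<in> verts (cyc n)" for x
    using that by (auto simp: glue_to_def N_def cyc_def)
  have wfX: "wf_digraph X" and wfD: "wf_digraph ?D"
    using f wf_glued_cyc[OF g] by (auto simp: gph_hom_def)
  have A: "arcs X = snd f ` arcs (cyc n)" and ia: "inj_on (snd f) (arcs (cyc n))"
    using bij by (auto simp: bij_betw_def)
  have t: "t \<in> gph_hom X ?D"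
    using f wfX wfD g ia
    by (auto simp: gph_hom_def t_def A onto[symmetric] glued_cyc_def gl cyc_ends)
  have q: "q \<in> gph_hom ?D X"
    using f wfX wfD g cyc_ends
    by (auto simp: gph_hom_def q_def glued_cyc_def)
  have qt: "mor_eq X (q \<odot> t) mor_id"
    using g ia unfolding mor_eq_def onto[symmetric] A
    by (auto simp: mor_comp_def q_def t_def mor_id_def intro: LeastI)
  have hom: "m \<in> gph_hom empty_gph Z" if "wf_digraph Z" for m and Z :: "'u gph"
    using that by (auto simp: gph_hom_def)
  have eq: "mor_eq empty_gph m m'" for m m' :: "'u mor"
    by (simp add: mor_eq_def)
  have "is_retract empty_gph X initial_mor empty_gph ?D (glued_mor g ?e N)"
    unfolding is_retract_def using hom wfX wfD wf_empty_gph t q qt eq by blast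
  moreover have "transfinite_comp empty_gph ?D (glued_mor g ?e N)"
    by (rule transfinite_comp_glued_cyc[OF g]) (simp add: N_def)
  ultimately show ?thesis
    unfolding cofibrant_def cofibration_def by blast
qed

theorem proposition4p2:
  fixes X :: "('u::infinite) gph"
  assumes "fin_digraph X"
    and "no_extra_isolated_node X"
  shows "eulerian X \<longleftrightarrow> cofibrant X \<and> cycle_with_nodes_identified X"
proof
  assume "eulerian X"
  then obtain n f where f: "f \<in> gph_hom (cyc n) X" "bij_betw (snd f) (arcs (cyc n)) (arcs X)"
    unfolding eulerian_def by blast
  with assms(2) have "fst f ` verts (cyc n) = verts X"
    by (intro eulerian_cycle_onto_verts)
  with f show "cofibrant X \<and> cycle_with_nodes_identified X"
    using cofibrant_if_onto cycle_with_nodes_identified_if_onto by blast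
next
  assume "cofibrant X \<and> cycle_with_nodes_identified X"
  then show "eulerian X"
    using assms(1) eulerian_if_cycle_with_nodes_identified by (auto simp: fin_digraph_def)
qed

end
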